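(* Let $l$ satisfy the following: for every realisation $\xi$, $l(\cdot;\xi)$ is $G$-Lipschitz with respect to $\|\cdot\|$ and differentiable with $\|\nabla l(x;\xi)-\nabla l(y;\xi)\|_*\le L\|x-y\|$ for all $x,y\in\mathbb{X}$; and $\mathbb{E}[\nabla l(x;\xi)]=\nabla l(x)$ for all $x\in\mathbb{X}$. Assume there is $D>0$ with $\|\mathcal{P}_{\mathcal{K}}(x,d,\eta')\|\le D$ for all $\eta'>0$, $x\in\mathcal{K}$, $d\in\mathbb{X}_*$, and there is $R>0$ with $f(x)\in[0,R]$ for all $x\in\mathcal{K}$. Let $\{d_t\}$ be any sequence of (random) vectors in $\mathbb{X}_*$, let $x_1\in\mathcal{K}$, and let $\{x_t\}$ be generated by $$v_t=\arg\min_{x\in\mathcal{K}}\ \langle d_t,x\rangle+r(x)+\eta\alpha_t\mathcal{B}_\phi(x,x_t),\qquad x_{t+1}=\Big(1-\frac{\alpha_t}{\alpha_{t+1}}\Big)x_t+\frac{\alpha_t}{\alpha_{t+1}}v_t,$$ with $$\alpha_1=1,\qquad \alpha_{t+1}=\max\Big\{\sqrt{\textstyle\sum_{s=1}^{t}\lambda_s^2\alpha_s^2\|v_s-x_s\|^2},\,1\Big\},\qquad \eta_t=\eta\,\alpha_t,$$ where $\eta>0$ is a constant and $\lambda\ge\lambda_t\ge\eta$ for all $t$. Then, for every $T\ge1$, $$\mathbb{E}\Big[\sum_{t=1}^T\|\mathcal{G}_{\mathcal{K}}(x_t,\nabla l(x_t),\eta_t)\|^2\Big]\le 8R^2\lambda^2+8R\eta+\frac{16L^2}{\eta^2}+10\sum_{t=1}^T\mathbb{E}[\sigma_t^2],$$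 where $\sigma_t^2=\|d_t-\nabla l(x_t)\|_*^2$.
   Context: $(\mathbb{X},\|\cdot\|)$ is a finite-dimensional real normed space with dual space $(\mathbb{X}_*,\|\cdot\|_* )$ and duality pairing $\langle\cdot,\cdot\rangle$. $\mathcal{K}\subseteq\mathbb{X}$ is a closed convex set, $l(x)=\mathbb{E}_\xi[l(x;\xi)]$ is a (possibly nonconvex) function on $\mathbb{X}$, $r$ is a convex function on $\mathbb{X}$, and $f=l+r$. $\phi$ is a distance-generating function, i.e. a differentiable function that is $1$-strongly convex with respect to $\|\cdot\|$, and $\mathcal{B}_\phi(x,y)=\phi(x)-\phi(y)-\langle\nabla\phi(y),x-y\rangle$ is its Bregman divergence. The generalised projection and generalised gradient map are $$\mathcal{P}_{\mathcal{K}}(x,d,\eta)=\arg\min_{y\in\mathcal{K}}\langle d,y\rangle+r(y)+\eta\mathcal{B}_\phi(y,x),\qquad \mathcal{G}_{\mathcal{K}}(x,d,\eta)=\eta\,(x-\mathcal{P}_{\mathcal{K}}(x,d,\eta)).$$ The minimisers are assumed to exist and the expectations to be well defined; $\lambda_t$ may depend on $x_t,v_t$. *)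

theory Defs
  imports "HOL-Probability.Probability"
begin

text \<open>
  The underlying space is a type of class real_normed_vector (finite-dimensionality is a
  hypothesis of the theorem).  Its dual is the type of bounded linear functionals, whose norm is
  the operator norm, i.e. the dual norm, and whose application is the duality pairing.
\<close>

definition grad :: "('a::real_normed_vector \<Rightarrow> real) \<Rightarrow> 'a \<Rightarrow> 'a \<Rightarrow>\<^sub>L real" where
  "grad f x = Blinfun (frechet_derivative f (at x))"

lemma has_derivative_grad:
  assumes "f differentiable (at x)"
  shows "(f has_derivative blinfun_apply (grad f x)) (at x)"
proof -
  have d: "(f has_derivative frechet_derivative f (at x)) (at x)"
    using assms frechet_derivative_works by blast
  then have "blinfun_apply (grad f x) = frechet_derivative f (at x)"
    unfolding grad_def by (simp add: bounded_linear_Blinfun_apply has_derivative_bounded_linear)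
  then show ?thesis using d by simp
qed

definition strongly_convex_on :: "'a::real_normed_vector set \<Rightarrow> real \<Rightarrow> ('a \<Rightarrow> real) \<Rightarrow> bool" where
  "strongly_convex_on S \<mu> f \<longleftrightarrow> convex S \<and>
    (\<forall>x\<in>S. \<forall>y\<in>S. \<forall>t. 0 \<le> t \<and> t \<le> 1 \<longrightarrow>
      f ((1 - t) *\<^sub>R x + t *\<^sub>R y)
        \<le> (1 - t) * f x + t * f y - \<mu> / 2 * t * (1 - t) * (norm (x - y))\<^sup>2)"

definition distance_generating :: "('a::real_normed_vector \<Rightarrow> real) \<Rightarrow> bool" where
  "distance_generating \<phi> \<longleftrightarrow> (\<forall>x. \<phi> differentiable (at x)) \<and> strongly_convex_on UNIV 1 \<phi>"

definition bregman :: "('a::real_normed_vector \<Rightarrow> real) \<Rightarrow> 'a \<Rightarrow> 'a \<Rightarrow> real" where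
  "bregman \<phi> x y = \<phi> x - \<phi> y - blinfun_apply (grad \<phi> y) (x - y)"

definition prox_objective ::
  "('a::real_normed_vector \<Rightarrow> real) \<Rightarrow> ('a \<Rightarrow> real) \<Rightarrow> 'a \<Rightarrow> ('a \<Rightarrow>\<^sub>L real) \<Rightarrow> real \<Rightarrow> 'a \<Rightarrow> real"
where
  "prox_objective r \<phi> x d \<eta> y = blinfun_apply d y + r y + \<eta> * bregman \<phi> y x"

text \<open>
  The selection made by arg_min_on is harmless: for convex r, distance-generating \<open>\<phi>\<close> and
  \<open>\<eta> > 0\<close> the objective is strongly convex, so there is at most one minimiser.  If no minimiser
  exists the value is unspecified.
\<close>

definition gen_proj ::
  "('a::real_normed_vector \<Rightarrow> real) \<Rightarrow> ('a \<Rightarrow> real) \<Rightarrow> 'a set \<Rightarrow> 'a \<Rightarrow> ('a \<Rightarrow>\<^sub>L real) \<Rightarrow> real \<Rightarrow> 'a"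
where
  "gen_proj r \<phi> K x d \<eta> = arg_min_on (prox_objective r \<phi> x d \<eta>) K"

definition gen_grad ::
  "('a::real_normed_vector \<Rightarrow> real) \<Rightarrow> ('a \<Rightarrow> real) \<Rightarrow> 'a set \<Rightarrow> 'a \<Rightarrow> ('a \<Rightarrow>\<^sub>L real) \<Rightarrow> real \<Rightarrow> 'a"
where
  "gen_grad r \<phi> K x d \<eta> = \<eta> *\<^sub>R (x - gen_proj r \<phi> K x d \<eta>)"

text \<open>
  Expectation of a random functional, taken pointwise.  On a finite-dimensional space this is the
  coordinatewise expectation.  The Bochner integral is not available here, because it requires the
  dual type to be of class second_countable_topology.
\<close>

definition has_dual_expectation ::
  "'z measure \<Rightarrow> ('z \<Rightarrow> 'a::real_normed_vector \<Rightarrow>\<^sub>L real) \<Rightarrow> ('a \<Rightarrow>\<^sub>L real) \<Rightarrow> bool"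
where
  "has_dual_expectation N F m \<longleftrightarrow>
    (\<forall>h. integrable N (\<lambda>\<xi>. blinfun_apply (F \<xi>) h) \<and>
         (\<integral>\<xi>. blinfun_apply (F \<xi>) h \<partial>N) = blinfun_apply m h)"

end

theory Submission imports Defs begin

text \<open>
  The inequality holds on every sample path, and the theorem is its expectation.  Fix a path and put
  \<open>a\<^sub>t = \<alpha>\<^sub>t \<parallel>v\<^sub>t - x\<^sub>t\<parallel>\<close> and \<open>S = \<Sum>\<^sub>t a\<^sub>t\<^sup>2\<close>.

  The prox objective with parameter \<open>\<mu> = \<eta> \<alpha>\<^sub>t\<close> is \<open>\<mu>\<close>-strongly convex, so it grows quadratically away
  from its minimiser (\<open>gen_proj_growth\<close>).  Comparing the minimisers for \<open>d\<^sub>t\<close> and for \<open>\<nabla>l(x\<^sub>t)\<close> shows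
  that they differ by at most \<open>\<sigma>\<^sub>t / \<mu>\<close>.  Hence the squared gradient map is at most
  \<open>2 \<eta>\<^sup>2 a\<^sub>t\<^sup>2 + 2 \<sigma>\<^sub>t\<^sup>2\<close> (\<open>gen_grad_estimate\<close>), and it remains to bound \<open>\<eta>\<^sup>2 S\<close>.

  Comparing \<open>v\<^sub>t\<close> with \<open>x\<^sub>t\<close> in the objective and using smoothness of \<open>l\<close> and convexity of \<open>r\<close> gives a
  decrease of \<open>f\<close> along the averaged step (\<open>composite_step_decrease\<close>).  The averaging weight
  \<open>\<alpha>\<^sub>t / \<alpha>\<^sub>t\<^sub>+\<^sub>1\<close> is such that multiplication by \<open>\<alpha>\<^sub>t\<^sub>+\<^sub>1\<close> turns this into
  \<open>\<eta> a\<^sub>t\<^sup>2 \<le> \<alpha>\<^sub>t\<^sub>+\<^sub>1 (f(x\<^sub>t) - f(x\<^sub>t\<^sub>+\<^sub>1)) + \<sigma>\<^sub>t a\<^sub>t + (L/2) a\<^sub>t\<^sup>2 / \<alpha>\<^sub>t\<^sub>+\<^sub>1\<close>.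
  Summed over \<open>t\<close>, the first term is at most \<open>R \<alpha>\<^sub>T\<^sub>+\<^sub>1 \<le> R (\<lambda> \<surd>S + 1)\<close> because the weights increase
  and \<open>f\<close> has values in \<open>[0, R]\<close> (\<open>weighted_telescope_bound\<close>).  The last term is of order
  \<open>\<surd>S\<close>, because \<open>\<alpha>\<^sub>t\<^sub>+\<^sub>1\<close> dominates \<open>\<eta>\<close> times the root of the partial sum of the \<open>a\<^sub>s\<^sup>2\<close>
  (\<open>adaptive_sum_bound\<close>).  So \<open>S\<close> is bounded by a constant, a multiple of its own square root
  and the noise, and Young's inequality solves this for \<open>S\<close> (\<open>adaptive_energy_bound\<close>).
\<close>

section \<open>Quadratic growth of strongly convex functions\<close>

text \<open>
  The strong convexity inequality on the segment from \<open>y\<close> to \<open>z\<close> is divided by \<open>t\<close>, and \<open>t\<close> tends to \<open>0\<close>.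
  The lower slope \<open>q\<close> covers two situations at once: a minimiser \<open>y\<close> of a possibly nonsmooth function, with
  \<open>q = 0\<close>, and a point of differentiability, with \<open>q\<close> the difference quotient.
\<close>

lemma strongly_convex_growth:
  assumes g: "strongly_convex_on S \<mu> g" and y: "y \<in> S" and z: "z \<in> S"
    and q: "(q \<longlongrightarrow> m) (at_right 0)"
    and qle: "\<And>t. 0 < t \<Longrightarrow> t < 1 \<Longrightarrow> t * q t \<le> g ((1 - t) *\<^sub>R y + t *\<^sub>R z) - g y"
  shows "g y + m + \<mu> / 2 * (norm (z - y))\<^sup>2 \<le> g z"
proof -
  have ev: "q t + \<mu> / 2 * (1 - t) * (norm (z - y))\<^sup>2 \<le> g z - g y" if t: "0 < t" "t < 1" for t
  proof -
    have "g ((1 - t) *\<^sub>R y + t *\<^sub>R z)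
        \<le> (1 - t) * g y + t * g z - \<mu> / 2 * t * (1 - t) * (norm (y - z))\<^sup>2"
      using g y z t unfolding strongly_convex_on_def by simp
    with qle[OF t] have "t * (q t + \<mu> / 2 * (1 - t) * (norm (z - y))\<^sup>2) \<le> t * (g z - g y)"
      by (simp add: algebra_simps norm_minus_commute)
    then show ?thesis using t by simp
  qed
  have "((\<lambda>t. q t + \<mu> / 2 * (1 - t) * (norm (z - y))\<^sup>2)
      \<longlongrightarrow> m + \<mu> / 2 * (1 - 0) * (norm (z - y))\<^sup>2) (at_right 0)"
    by (intro tendsto_intros q)
  moreover have "eventually (\<lambda>t. q t + \<mu> / 2 * (1 - t) * (norm (z - y))\<^sup>2 \<le> g z - g y) (at_right 0)"
    unfolding eventually_at_right_field using ev by (intro exI[of _ 1]) auto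
  ultimately have "m + \<mu> / 2 * (1 - 0) * (norm (z - y))\<^sup>2 \<le> g z - g y"
    by (rule tendsto_upperbound) simp
  then show ?thesis by simp
qed

lemma has_real_derivative_along_line:
  assumes "g differentiable (at (x + t *\<^sub>R h))"
  shows "((\<lambda>t. g (x + t *\<^sub>R h)) has_real_derivative grad g (x + t *\<^sub>R h) h) (at t)"
proof -
  have "((\<lambda>t. x + t *\<^sub>R h) has_derivative (\<lambda>s. s *\<^sub>R h)) (at t)"
    by (auto intro!: derivative_eq_intros)
  from has_derivative_compose[OF this has_derivative_grad[OF assms]]
  show ?thesis
    by (simp add: has_field_derivative_def blinfun.scaleR_right mult_commute_abs)
qed

text \<open>The difference quotients of \<open>\<phi>\<close> towards \<open>y\<close> serve as the lower slope at \<open>x\<close>.\<close>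

lemma bregman_lower_bound:
  assumes "distance_generating \<phi>"
  shows "(norm (y - x))\<^sup>2 / 2 \<le> bregman \<phi> y x"
proof -
  have sc: "strongly_convex_on UNIV 1 \<phi>" and df: "\<phi> differentiable (at x)"
    using assms unfolding distance_generating_def by auto
  have "((\<lambda>t. \<phi> (x + t *\<^sub>R (y - x))) has_real_derivative grad \<phi> x (y - x)) (at 0)"
    using has_real_derivative_along_line[of \<phi> x 0 "y - x"] df by simp
  then have "((\<lambda>t. (\<phi> (x + t *\<^sub>R (y - x)) - \<phi> x) / t) \<longlongrightarrow> grad \<phi> x (y - x)) (at 0)"
    by (simp add: has_field_derivative_iff)
  then have "((\<lambda>t. (\<phi> (x + t *\<^sub>R (y - x)) - \<phi> x) / t) \<longlongrightarrow> grad \<phi> x (y - x)) (at_right 0)"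
    by (rule tendsto_within_subset) simp
  then have "\<phi> x + grad \<phi> x (y - x) + 1 / 2 * (norm (y - x))\<^sup>2 \<le> \<phi> y"
  proof (rule strongly_convex_growth[OF sc UNIV_I UNIV_I])
    fix t :: real assume "0 < t" "t < 1"
    moreover have "(1 - t) *\<^sub>R x + t *\<^sub>R y = x + t *\<^sub>R (y - x)"
      by (simp add: algebra_simps)
    ultimately show "t * ((\<phi> (x + t *\<^sub>R (y - x)) - \<phi> x) / t) \<le> \<phi> ((1 - t) *\<^sub>R x + t *\<^sub>R y) - \<phi> x"
      by simp
  qed
  then show ?thesis unfolding bregman_def by simp
qed

section \<open>The generalised projection\<close>

text \<open>
  For fixed \<open>x\<close>, the Bregman divergence differs from \<open>\<phi>\<close> by an affine function and so inherits its
  strong convexity; the remaining terms of the objective are convex.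
\<close>

lemma prox_objective_strongly_convex:
  assumes K: "convex K" and r: "convex_on UNIV r" and phi: "distance_generating \<phi>"
    and eta: "\<eta> > 0"
  shows "strongly_convex_on K \<eta> (prox_objective r \<phi> x d \<eta>)"
  unfolding strongly_convex_on_def
proof (intro conjI ballI allI impI)
  show "convex K" by (rule K)
next
  fix y z :: 'a and t :: real
  assume t: "0 \<le> t \<and> t \<le> 1"
  let ?w = "(1 - t) *\<^sub>R y + t *\<^sub>R z"
  have rw: "r ?w \<le> (1 - t) * r y + t * r z"
    using convex_onD[OF r, of t y z] t by simp
  have "\<phi> ?w \<le> (1 - t) * \<phi> y + t * \<phi> z - 1 / 2 * t * (1 - t) * (norm (y - z))\<^sup>2"
    using phi t unfolding distance_generating_def strongly_convex_on_def by simp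
  moreover have "?w - x = (1 - t) *\<^sub>R (y - x) + t *\<^sub>R (z - x)"
    by (simp add: algebra_simps)
  then have "grad \<phi> x (?w - x) = (1 - t) * grad \<phi> x (y - x) + t * grad \<phi> x (z - x)"
    by (simp only: blinfun.add_right blinfun.scaleR_right real_scaleR_def)
  ultimately have "bregman \<phi> ?w x \<le> (1 - t) * bregman \<phi> y x + t * bregman \<phi> z x
      - 1 / 2 * t * (1 - t) * (norm (y - z))\<^sup>2"
    unfolding bregman_def by (simp add: algebra_simps)
  from mult_left_mono[OF this, of \<eta>] eta
  have "\<eta> * bregman \<phi> ?w x \<le> (1 - t) * (\<eta> * bregman \<phi> y x) + t * (\<eta> * bregman \<phi> z x)
      - \<eta> / 2 * t * (1 - t) * (norm (y - z))\<^sup>2"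
    by (simp add: algebra_simps)
  moreover have "d ?w = (1 - t) * d y + t * d z"
    by (simp only: blinfun.add_right blinfun.scaleR_right real_scaleR_def)
  ultimately show "prox_objective r \<phi> x d \<eta> ?w \<le> (1 - t) * prox_objective r \<phi> x d \<eta> y
      + t * prox_objective r \<phi> x d \<eta> z - \<eta> / 2 * t * (1 - t) * (norm (y - z))\<^sup>2"
    unfolding prox_objective_def using rw by (simp only: distrib_left)
qed

lemma gen_proj_is_arg_min:
  assumes "\<exists>z. is_arg_min (prox_objective r \<phi> x d \<eta>) (\<lambda>z. z \<in> K) z"
  shows "is_arg_min (prox_objective r \<phi> x d \<eta>) (\<lambda>z. z \<in> K) (gen_proj r \<phi> K x d \<eta>)"
  using someI_ex[OF assms] unfolding gen_proj_def arg_min_on_def arg_min_def .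

lemma gen_proj_growth:
  assumes K: "convex K" and r: "convex_on UNIV r" and phi: "distance_generating \<phi>"
    and eta: "\<eta> > 0" and z: "z \<in> K"
    and ex: "\<exists>z. is_arg_min (prox_objective r \<phi> x d \<eta>) (\<lambda>z. z \<in> K) z"
  defines "p \<equiv> gen_proj r \<phi> K x d \<eta>"
  shows "prox_objective r \<phi> x d \<eta> p + \<eta> / 2 * (norm (z - p))\<^sup>2 \<le> prox_objective r \<phi> x d \<eta> z"
proof -
  let ?g = "prox_objective r \<phi> x d \<eta>"
  have p: "p \<in> K" "\<And>y. y \<in> K \<Longrightarrow> ?g p \<le> ?g y"
    using gen_proj_is_arg_min[OF ex] unfolding p_def[symmetric] is_arg_min_linorder by auto
  have "?g p + 0 + \<eta> / 2 * (norm (z - p))\<^sup>2 \<le> ?g z"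
  proof (rule strongly_convex_growth[OF prox_objective_strongly_convex[OF K r phi eta] p(1) z tendsto_const])
    fix t :: real assume "0 < t" "t < 1"
    then have "(1 - t) *\<^sub>R p + t *\<^sub>R z \<in> K"
      using K p(1) z by (simp add: convex_alt)
    then show "t * 0 \<le> ?g ((1 - t) *\<^sub>R p + t *\<^sub>R z) - ?g p" using p(2) by simp
  qed
  then show ?thesis by simp
qed

text \<open>
  Growth at the minimiser, compared with the value at \<open>x\<close>, contributes one half of the quadratic term;
  the lower bound on the Bregman divergence contributes the other half.
\<close>

lemma gen_proj_decrease:
  assumes K: "convex K" and r: "convex_on UNIV r" and phi: "distance_generating \<phi>"
    and eta: "\<eta> > 0" and x: "x \<in> K"
    and ex: "\<exists>z. is_arg_min (prox_objective r \<phi> x d \<eta>) (\<lambda>z. z \<in> K) z"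
  defines "p \<equiv> gen_proj r \<phi> K x d \<eta>"
  shows "d (p - x) + r p - r x \<le> - \<eta> * (norm (p - x))\<^sup>2"
proof -
  have "prox_objective r \<phi> x d \<eta> p + \<eta> / 2 * (norm (x - p))\<^sup>2 \<le> prox_objective r \<phi> x d \<eta> x"
    unfolding p_def by (rule gen_proj_growth[OF K r phi eta x ex])
  moreover have "\<eta> * ((norm (p - x))\<^sup>2 / 2) \<le> \<eta> * bregman \<phi> p x"
    using bregman_lower_bound[OF phi, of p x] eta by simp
  moreover have "bregman \<phi> x x = 0" by (simp add: bregman_def)
  ultimately show ?thesis
    unfolding prox_objective_def by (simp add: norm_minus_commute blinfun.diff_right)
qed

text \<open>
  Each of the two minimisers is a competitor in the other's problem.  In the sum of the two growth
  inequalities everything cancels except \<open>d - e\<close>, evaluated at the difference of the minimisers.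
\<close>

lemma gen_proj_lipschitz_dual:
  assumes K: "convex K" and r: "convex_on UNIV r" and phi: "distance_generating \<phi>"
    and eta: "\<eta> > 0"
    and ex: "\<And>g. \<exists>z. is_arg_min (prox_objective r \<phi> x g \<eta>) (\<lambda>z. z \<in> K) z"
  shows "\<eta> * norm (gen_proj r \<phi> K x d \<eta> - gen_proj r \<phi> K x e \<eta>) \<le> norm (d - e)"
proof -
  define p where "p = gen_proj r \<phi> K x d \<eta>"
  define q where "q = gen_proj r \<phi> K x e \<eta>"
  have mem: "p \<in> K" "q \<in> K"
    using gen_proj_is_arg_min[OF ex] unfolding p_def q_def is_arg_min_def by auto
  have "prox_objective r \<phi> x d \<eta> p + \<eta> / 2 * (norm (q - p))\<^sup>2 \<le> prox_objective r \<phi> x d \<eta> q"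
    unfolding p_def by (rule gen_proj_growth[OF K r phi eta mem(2) ex])
  moreover have "prox_objective r \<phi> x e \<eta> q + \<eta> / 2 * (norm (p - q))\<^sup>2 \<le> prox_objective r \<phi> x e \<eta> p"
    unfolding q_def by (rule gen_proj_growth[OF K r phi eta mem(1) ex])
  ultimately have "\<eta> * (norm (p - q))\<^sup>2 \<le> (d - e) (q - p)"
    unfolding prox_objective_def
    by (simp add: norm_minus_commute blinfun.diff_right blinfun.diff_left)
  also have "\<dots> \<le> norm (d - e) * norm (p - q)"
    using norm_blinfun[of "d - e" "q - p"] by (simp add: norm_minus_commute)
  finally have "(\<eta> * norm (p - q)) * norm (p - q) \<le> norm (d - e) * norm (p - q)"
    by (simp add: power2_eq_square mult.assoc)
  then show ?thesis
    unfolding p_def[symmetric] q_def[symmetric]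
    by (cases "p = q") auto
qed

text \<open>
  This replaces the projection along the exact gradient \<open>e\<close> by the one along its estimate \<open>d\<close>; the factor
  \<open>\<eta>\<close> in the gradient map cancels the factor \<open>1 / \<eta>\<close> in the stability of the projection.
\<close>

lemma gen_grad_estimate:
  assumes K: "convex K" and r: "convex_on UNIV r" and phi: "distance_generating \<phi>"
    and eta: "\<eta> > 0"
    and ex: "\<And>g. \<exists>z. is_arg_min (prox_objective r \<phi> x g \<eta>) (\<lambda>z. z \<in> K) z"
  shows "(norm (gen_grad r \<phi> K x e \<eta>))\<^sup>2
      \<le> 2 * (\<eta> * norm (gen_proj r \<phi> K x d \<eta> - x))\<^sup>2 + 2 * (norm (d - e))\<^sup>2"
proof -
  define p where "p = gen_proj r \<phi> K x d \<eta>"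
  define q where "q = gen_proj r \<phi> K x e \<eta>"
  have "norm (x - q) \<le> norm (p - x) + norm (p - q)"
    using norm_triangle_ineq[of "x - p" "p - q"] by (simp add: norm_minus_commute)
  then have "\<eta> * norm (x - q) \<le> \<eta> * norm (p - x) + \<eta> * norm (p - q)"
    using eta by (metis distrib_left less_imp_le mult_left_mono)
  also have "\<eta> * norm (p - q) \<le> norm (d - e)"
    unfolding p_def q_def by (rule gen_proj_lipschitz_dual[OF K r phi eta ex])
  finally have "(\<eta> * norm (x - q))\<^sup>2 \<le> (\<eta> * norm (p - x) + norm (d - e))\<^sup>2"
    using eta by (intro power_mono) auto
  also have "\<dots> \<le> 2 * (\<eta> * norm (p - x))\<^sup>2 + 2 * (norm (d - e))\<^sup>2"
    using zero_le_power2[of "\<eta> * norm (p - x) - norm (d - e)"]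
    by (simp add: power2_eq_square algebra_simps)
  finally show ?thesis
    unfolding gen_grad_def p_def q_def using eta by (simp add: power_mult_distrib)
qed

section \<open>Descent along an averaged proximal step\<close>

text \<open>
  The pointwise expectation of a functional is tested on one vector at a time, so a uniform bound
  on the realisations passes to the dual norm of the difference of the means.
\<close>

lemma dual_expectation_diff_bound:
  assumes N: "prob_space N"
    and F: "has_dual_expectation N F m" "has_dual_expectation N F' m'"
    and le: "\<And>\<xi>. \<xi> \<in> space N \<Longrightarrow> norm (F \<xi> - F' \<xi>) \<le> B" and B: "B \<ge> 0"
  shows "norm (m - m') \<le> B"
proof (rule norm_blinfun_bound[OF B])
  interpret prob_space N by (rule N)
  fix h
  have int: "integrable N (\<lambda>\<xi>. F \<xi> h)" "integrable N (\<lambda>\<xi>. F' \<xi> h)"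
    and eq: "m h = (\<integral>\<xi>. F \<xi> h \<partial>N)" "m' h = (\<integral>\<xi>. F' \<xi> h \<partial>N)"
    using F unfolding has_dual_expectation_def by auto
  have "norm ((m - m') h) = norm (\<integral>\<xi>. F \<xi> h - F' \<xi> h \<partial>N)"
    using int by (simp add: eq blinfun.diff_left)
  also have "\<dots> \<le> (\<integral>\<xi>. norm (F \<xi> h - F' \<xi> h) \<partial>N)"
    by (rule integral_norm_bound)
  also have "\<dots> \<le> (\<integral>\<xi>. B * norm h \<partial>N)"
  proof (rule integral_mono)
    fix \<xi> assume "\<xi> \<in> space N"
    have "norm (F \<xi> h - F' \<xi> h) \<le> norm (F \<xi> - F' \<xi>) * norm h"
      using norm_blinfun[of "F \<xi> - F' \<xi>" h] by (simp add: blinfun.diff_left)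
    also have "\<dots> \<le> B * norm h"
      using le[OF \<open>\<xi> \<in> space N\<close>] by (intro mult_right_mono) auto
    finally show "norm (F \<xi> h - F' \<xi> h) \<le> B * norm h" .
  qed (use int in auto)
  also have "\<dots> = B * norm h" by (simp add: prob_space)
  finally show "norm ((m - m') h) \<le> B * norm h" .
qed

text \<open>
  Along the segment from \<open>x\<close> to \<open>x + h\<close>, the derivative of the difference of the two sides is
  nonpositive by the Lipschitz bound on the gradient.
\<close>

lemma smooth_upper_bound:
  assumes diff: "\<And>y. l differentiable (at y)"
    and smooth: "\<And>y z. norm (grad l y - grad l z) \<le> L * norm (y - z)"
  shows "l (x + h) \<le> l x + grad l x h + L / 2 * (norm h)\<^sup>2"
proof -
  define g where "g t = l (x + t *\<^sub>R h) - t * grad l x h - L / 2 * t\<^sup>2 * (norm h)\<^sup>2" for t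
  have "g 1 \<le> g 0"
  proof (rule DERIV_nonpos_imp_nonincreasing[where f = g and a = 0 and b = 1])
    fix t :: real assume t: "0 \<le> t" "t \<le> 1"
    have "(g has_real_derivative grad l (x + t *\<^sub>R h) h - grad l x h - L * t * (norm h)\<^sup>2) (at t)"
      unfolding g_def
      by (auto intro!: derivative_eq_intros has_real_derivative_along_line diff)
    moreover have "grad l (x + t *\<^sub>R h) h - grad l x h \<le> norm (grad l (x + t *\<^sub>R h) - grad l x) * norm h"
      using norm_blinfun[of "grad l (x + t *\<^sub>R h) - grad l x" h] by (simp add: blinfun.diff_left)
    moreover have "\<dots> \<le> (L * (t * norm h)) * norm h"
      using smooth[of "x + t *\<^sub>R h" x] t by (intro mult_right_mono) auto
    ultimately show "\<exists>y. (g has_real_derivative y) (at t) \<and> y \<le> 0"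
      by (intro exI conjI) (auto simp: power2_eq_square mult.assoc)
  qed simp
  then show ?thesis by (simp add: g_def)
qed

text \<open>
  With convexity of \<open>r\<close>, and smoothness of \<open>l\<close> up to a term of second order in \<open>b\<close>, the change of the
  objective is at most \<open>b\<close> times the change under the full step to \<open>p\<close> of its model, in which \<open>l\<close> is
  linearised at \<open>x\<close>.  The full step decreases the model built on \<open>d\<close>, and the error of \<open>d\<close> enters
  linearly.
\<close>

lemma composite_step_decrease:
  fixes x p :: "'a::real_normed_vector"
  assumes K: "convex K" and r: "convex_on UNIV r" and phi: "distance_generating \<phi>"
    and eta: "\<eta> > 0" and x: "x \<in> K"
    and ex: "\<exists>z. is_arg_min (prox_objective r \<phi> x d \<eta>) (\<lambda>z. z \<in> K) z"
    and diff: "\<And>y. l differentiable (at y)"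
    and smooth: "\<And>y z. norm (grad l y - grad l z) \<le> L * norm (y - z)"
    and b: "0 \<le> b" "b \<le> 1"
    and p: "p = gen_proj r \<phi> K x d \<eta>"
  defines "x' \<equiv> (1 - b) *\<^sub>R x + b *\<^sub>R p"
  shows "l x' + r x' \<le> l x + r x
      + b * (norm (d - grad l x) * norm (p - x) - \<eta> * (norm (p - x))\<^sup>2)
      + L / 2 * b\<^sup>2 * (norm (p - x))\<^sup>2"
proof -
  have x': "x' = x + b *\<^sub>R (p - x)" unfolding x'_def by (simp add: algebra_simps)
  have "l x' \<le> l x + b * grad l x (p - x) + L / 2 * b\<^sup>2 * (norm (p - x))\<^sup>2"
    using smooth_upper_bound[OF diff smooth, of x "b *\<^sub>R (p - x)"]
    by (simp add: x' blinfun.scaleR_right power_mult_distrib)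
  moreover have "r x' \<le> (1 - b) * r x + b * r p"
    using convex_onD[OF r, of b x p] b unfolding x'_def by simp
  moreover have "b * (grad l x (p - x) + r p - r x)
      \<le> b * (norm (d - grad l x) * norm (p - x) - \<eta> * (norm (p - x))\<^sup>2)"
  proof (rule mult_left_mono[OF _ b(1)])
    have "d (p - x) + r p - r x \<le> - \<eta> * (norm (p - x))\<^sup>2"
      unfolding p by (rule gen_proj_decrease[OF K r phi eta x ex])
    moreover have "grad l x (p - x) - d (p - x) \<le> norm (d - grad l x) * norm (p - x)"
      using norm_blinfun[of "d - grad l x" "p - x"] by (simp add: blinfun.diff_left)
    ultimately show "grad l x (p - x) + r p - r x
        \<le> norm (d - grad l x) * norm (p - x) - \<eta> * (norm (p - x))\<^sup>2" by simp
  qed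
  ultimately show ?thesis by (simp add: algebra_simps)
qed

section \<open>Summation with adaptive weights\<close>

text \<open>
  A discrete form of \<open>\<integral> dS / \<surd>S = 2 \<surd>S\<close>: with partial sums \<open>p\<^sup>2\<close> and \<open>q\<^sup>2\<close> after and before the
  step, the increment \<open>(p - q) (p + q)\<close> is at most \<open>2 p (p - q)\<close>, and \<open>c p\<close> is at most the new weight.
\<close>

lemma adaptive_sum_bound:
  fixes a \<alpha> :: "nat \<Rightarrow> real"
  assumes c: "c > 0"
    and pos: "\<And>t. t \<ge> 1 \<Longrightarrow> \<alpha> (t + 1) > 0"
    and low: "\<And>t. t \<ge> 1 \<Longrightarrow> c * sqrt (\<Sum>s=1..t. (a s)\<^sup>2) \<le> \<alpha> (t + 1)"
  shows "(\<Sum>t=1..T. (a t)\<^sup>2 / \<alpha> (t + 1)) \<le> 2 / c * sqrt (\<Sum>t=1..T. (a t)\<^sup>2)"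
proof (induction T)
  case (Suc T)
  define p where "p = sqrt (\<Sum>t=1..Suc T. (a t)\<^sup>2)"
  define q where "q = sqrt (\<Sum>t=1..T. (a t)\<^sup>2)"
  have sq: "p\<^sup>2 = q\<^sup>2 + (a (Suc T))\<^sup>2"
    unfolding p_def q_def by (simp add: sum_nonneg)
  have ord: "0 \<le> q" "q \<le> p"
    unfolding p_def q_def by (auto simp: sum_nonneg)
  have "c * (a (Suc T))\<^sup>2 = c * ((p - q) * (p + q))"
    using sq by (simp add: power2_eq_square algebra_simps)
  also have "\<dots> \<le> c * ((p - q) * (2 * p))"
    using c ord by (intro mult_left_mono) auto
  also have "\<dots> = 2 * (p - q) * (c * p)" by simp
  also have "\<dots> \<le> 2 * (p - q) * \<alpha> (Suc T + 1)"
    using low[of "Suc T"] ord unfolding p_def[symmetric] by (intro mult_left_mono) auto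
  finally have "(a (Suc T))\<^sup>2 / \<alpha> (Suc T + 1) \<le> 2 / c * (p - q)"
    using c pos[of "Suc T"] by (simp add: field_simps)
  with Suc show ?case
    unfolding q_def[symmetric] p_def[symmetric] by (simp add: right_diff_distrib)
qed simp

text \<open>
  Summation by parts: the coefficient of \<open>F t\<close> becomes an increment of \<open>\<alpha>\<close>, which is nonnegative, so
  each value can be replaced by \<open>R\<close>, and then the increments telescope.
\<close>

lemma weighted_telescope_bound:
  fixes \<alpha> F :: "nat \<Rightarrow> real"
  assumes one: "\<alpha> 1 \<ge> 0" and mono: "\<And>t. t \<ge> 1 \<Longrightarrow> \<alpha> t \<le> \<alpha> (t + 1)"
    and F: "\<And>t. t \<ge> 1 \<Longrightarrow> F t \<in> {0..R}"
  shows "(\<Sum>t=1..T. \<alpha> (t + 1) * (F t - F (t + 1))) \<le> R * \<alpha> (T + 1)"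
proof -
  have nn: "\<alpha> (T + 1) \<ge> 0" for T
    by (induction T) (use one mono in \<open>auto intro: order_trans\<close>)
  \<comment> \<open>The subtracted boundary term makes the induction close.\<close>
  have "(\<Sum>t=1..T. \<alpha> (t + 1) * (F t - F (t + 1))) \<le> R * \<alpha> (T + 1) - \<alpha> (T + 1) * F (T + 1)"
  proof (induction T)
    case 0
    show ?case using mult_left_mono[of "F 1" R "\<alpha> 1"] F[of 1] one by (simp add: mult.commute)
  next
    case (Suc T)
    have "(\<alpha> (T + 2) - \<alpha> (T + 1)) * F (T + 1) \<le> (\<alpha> (T + 2) - \<alpha> (T + 1)) * R"
      using mono[of "T + 1"] F[of "T + 1"] by (intro mult_left_mono) auto
    with Suc show ?case by (simp add: algebra_simps)
  qed
  also have "\<dots> \<le> R * \<alpha> (T + 1)" using nn[of T] F[of "T + 1"] by simp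
  finally show ?thesis .
qed

text \<open>
  In the summed descent inequality both \<open>\<alpha> (T + 1)\<close> and the sum of \<open>(a t)\<^sup>2 / \<alpha> (t + 1)\<close> are only of
  order \<open>\<surd>S\<close>, where \<open>S\<close> is the sum of the \<open>(a t)\<^sup>2\<close>, while the left-hand side is \<open>\<eta> S\<close>.  The inequality is
  therefore quadratic in \<open>y = \<eta> \<surd>S\<close> and bounds \<open>y\<close>.
\<close>

lemma adaptive_energy_bound:
  fixes a \<sigma> \<alpha> lam F :: "nat \<Rightarrow> real"
  assumes eta: "\<eta> > 0" and L: "L \<ge> 0" and R: "R \<ge> 0"
    and lam: "\<And>t. t \<ge> 1 \<Longrightarrow> \<eta> \<le> lam t \<and> lam t \<le> lambar"
    and alpha1: "\<alpha> 1 = 1"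
    and alpha_step: "\<And>t. t \<ge> 1 \<Longrightarrow> \<alpha> (t + 1) = max (sqrt (\<Sum>s=1..t. (lam s)\<^sup>2 * (a s)\<^sup>2)) 1"
    and mono: "\<And>t. t \<ge> 1 \<Longrightarrow> \<alpha> t \<le> \<alpha> (t + 1)"
    and F: "\<And>t. t \<ge> 1 \<Longrightarrow> F t \<in> {0..R}"
    and step: "\<And>t. t \<ge> 1 \<Longrightarrow> \<alpha> (t + 1) * (F (t + 1) - F t)
        \<le> \<sigma> t * a t - \<eta> * (a t)\<^sup>2 + L / 2 * ((a t)\<^sup>2 / \<alpha> (t + 1))"
    and T: "T \<ge> 1"
  shows "\<eta>\<^sup>2 * (\<Sum>t=1..T. (a t)\<^sup>2)
      \<le> 4 * R\<^sup>2 * lambar\<^sup>2 + 4 * R * \<eta> + 8 * L\<^sup>2 / \<eta>\<^sup>2 + 4 * (\<Sum>t=1..T. (\<sigma> t)\<^sup>2)"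
proof -
  define S where "S = (\<Sum>t=1..T. (a t)\<^sup>2)"
  define V where "V = (\<Sum>t=1..T. (\<sigma> t)\<^sup>2)"
  define y where "y = \<eta> * sqrt S"
  have S0: "S \<ge> 0" unfolding S_def by (simp add: sum_nonneg)
  have y2: "y\<^sup>2 = \<eta>\<^sup>2 * S" unfolding y_def using S0 by (simp add: power_mult_distrib)
  have low: "\<eta> * sqrt (\<Sum>s=1..t. (a s)\<^sup>2) \<le> \<alpha> (t + 1)" if "t \<ge> 1" for t
  proof -
    have "\<eta> * sqrt (\<Sum>s=1..t. (a s)\<^sup>2) = sqrt (\<Sum>s=1..t. \<eta>\<^sup>2 * (a s)\<^sup>2)"
      using eta by (simp add: sum_distrib_left[symmetric] real_sqrt_mult)
    also have "\<dots> \<le> sqrt (\<Sum>s=1..t. (lam s)\<^sup>2 * (a s)\<^sup>2)"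
      using lam eta by (intro real_sqrt_le_mono sum_mono mult_right_mono power_mono) auto
    finally show ?thesis using alpha_step[OF that] by simp
  qed
  have up: "\<alpha> (T + 1) \<le> lambar * sqrt S + 1"
  proof -
    have lb: "0 \<le> lambar" using lam[of 1] eta by auto
    have "sqrt (\<Sum>s=1..T. (lam s)\<^sup>2 * (a s)\<^sup>2) \<le> sqrt (\<Sum>s=1..T. lambar\<^sup>2 * (a s)\<^sup>2)"
      using lam eta
      by (intro real_sqrt_le_mono sum_mono mult_right_mono power_mono)
         (auto intro: order_trans[OF less_imp_le])
    also have "\<dots> = lambar * sqrt S"
      unfolding S_def using lb by (simp add: sum_distrib_left[symmetric] real_sqrt_mult)
    finally show ?thesis using alpha_step[OF T] lb S0 by simp
  qed
  have young: "\<eta> * (\<sigma> t * a t) \<le> (\<sigma> t)\<^sup>2 + \<eta>\<^sup>2 * (a t)\<^sup>2 / 4" for t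
    using zero_le_power2[of "\<sigma> t - \<eta> * a t / 2"]
    by (simp add: power2_eq_square algebra_simps)
  have "\<eta>\<^sup>2 * S \<le> (\<Sum>t=1..T. \<eta> * (\<alpha> (t + 1) * (F t - F (t + 1)))
      + ((\<sigma> t)\<^sup>2 + \<eta>\<^sup>2 * (a t)\<^sup>2 / 4) + \<eta> * L / 2 * ((a t)\<^sup>2 / \<alpha> (t + 1)))"
    unfolding S_def sum_distrib_left
  proof (rule sum_mono)
    fix t assume "t \<in> {1..T}"
    then have "t \<ge> 1" by simp
    from mult_left_mono[OF step[OF this], of \<eta>] eta young[of t]
    show "\<eta>\<^sup>2 * (a t)\<^sup>2 \<le> \<eta> * (\<alpha> (t + 1) * (F t - F (t + 1)))
      + ((\<sigma> t)\<^sup>2 + \<eta>\<^sup>2 * (a t)\<^sup>2 / 4) + \<eta> * L / 2 * ((a t)\<^sup>2 / \<alpha> (t + 1))"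
      by (simp add: algebra_simps power2_eq_square)
  qed
  also have "\<dots> = \<eta> * (\<Sum>t=1..T. \<alpha> (t + 1) * (F t - F (t + 1)))
      + (V + \<eta>\<^sup>2 * S / 4) + \<eta> * L / 2 * (\<Sum>t=1..T. (a t)\<^sup>2 / \<alpha> (t + 1))"
    unfolding S_def V_def by (simp add: sum.distrib sum_distrib_left sum_divide_distrib)
  also have "\<dots> \<le> \<eta> * (R * (lambar * sqrt S + 1)) + (V + \<eta>\<^sup>2 * S / 4)
      + \<eta> * L / 2 * (2 / \<eta> * sqrt S)"
  proof (intro add_mono mult_left_mono order_refl)
    have "(\<Sum>t=1..T. \<alpha> (t + 1) * (F t - F (t + 1))) \<le> R * \<alpha> (T + 1)"
      by (rule weighted_telescope_bound) (use alpha1 mono F in auto)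
    also have "\<dots> \<le> R * (lambar * sqrt S + 1)" using up R by (rule mult_left_mono)
    finally show "(\<Sum>t=1..T. \<alpha> (t + 1) * (F t - F (t + 1))) \<le> R * (lambar * sqrt S + 1)" .
    show "(\<Sum>t=1..T. (a t)\<^sup>2 / \<alpha> (t + 1)) \<le> 2 / \<eta> * sqrt S"
      unfolding S_def by (rule adaptive_sum_bound[OF eta _ low]) (use alpha_step in \<open>force simp: less_max_iff_disj\<close>)+
  qed (use eta L in auto)
  also have "\<dots> = R * \<eta> + (R * lambar) * y + V + y\<^sup>2 / 4 + (L / \<eta>) * y"
    unfolding y2 unfolding y_def using eta by (simp add: field_simps)
  finally have "y\<^sup>2 \<le> R * \<eta> + (R * lambar) * y + V + y\<^sup>2 / 4 + (L / \<eta>) * y"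
    unfolding y2 .
  moreover have "(R * lambar) * y \<le> R\<^sup>2 * lambar\<^sup>2 + y\<^sup>2 / 4"
    using zero_le_power2[of "R * lambar - y / 2"] by (simp add: power2_eq_square algebra_simps)
  moreover have "(L / \<eta>) * y \<le> 2 * (L / \<eta>)\<^sup>2 + y\<^sup>2 / 8"
    using zero_le_power2[of "4 * (L / \<eta>) - y"]
    unfolding power2_diff power_mult_distrib by simp
  \<comment> \<open>The three uses of Young's inequality absorb \<open>1/4 + 1/4 + 1/8 = 5/8\<close> of \<open>y\<^sup>2\<close>.  What is left exceeds
    the quarter that the factor \<open>4\<close> on the right requires.\<close>
  ultimately have "y\<^sup>2 \<le> 4 * R\<^sup>2 * lambar\<^sup>2 + 4 * R * \<eta> + 8 * (L / \<eta>)\<^sup>2 + 4 * V"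
    using zero_le_power2[of y] by linarith
  then show ?thesis unfolding y2 S_def V_def by (simp add: power_divide)
qed

section \<open>The expected sum of squared gradient maps\<close>

theorem theorem3p2:
  fixes K :: "'a::real_normed_vector set"
    and N :: "'z measure" and ls :: "'a \<Rightarrow> 'z \<Rightarrow> real"
    and l r f \<phi> :: "'a \<Rightarrow> real"
    and M :: "'w measure"
    and d :: "nat \<Rightarrow> 'w \<Rightarrow> 'a \<Rightarrow>\<^sub>L real"
    and x v :: "nat \<Rightarrow> 'w \<Rightarrow> 'a" and x1 :: 'a
    and \<alpha> lam :: "nat \<Rightarrow> 'w \<Rightarrow> real"
    and G L D R \<eta> lambar :: real and T :: nat
  assumes fin_dim: "\<exists>B. finite B \<and> span B = (UNIV :: 'a set)"
    and K: "closed K" "convex K"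
    and r: "convex_on UNIV r"
    and phi: "distance_generating \<phi>"
    and N: "prob_space N"
    and l: "\<And>y. integrable N (ls y)" "\<And>y. l y = (\<integral>\<xi>. ls y \<xi> \<partial>N)"
    and f: "\<And>y. f y = l y + r y"
    and minimisers_exist: "\<And>y g \<eta>'. y \<in> K \<Longrightarrow> \<eta>' > 0 \<Longrightarrow>
      \<exists>z. is_arg_min (prox_objective r \<phi> y g \<eta>') (\<lambda>z. z \<in> K) z"
    and ls_lipschitz: "\<And>\<xi>. \<xi> \<in> space N \<Longrightarrow> G-lipschitz_on UNIV (\<lambda>y. ls y \<xi>)"
    and ls_differentiable: "\<And>\<xi> y. \<xi> \<in> space N \<Longrightarrow> (\<lambda>y. ls y \<xi>) differentiable (at y)"
    and ls_smooth: "\<And>\<xi> y z. \<xi> \<in> space N \<Longrightarrow>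
      norm (grad (\<lambda>y. ls y \<xi>) y - grad (\<lambda>y. ls y \<xi>) z) \<le> L * norm (y - z)"
    and l_differentiable: "\<And>y. l differentiable (at y)"
    and unbiased: "\<And>y. has_dual_expectation N (\<lambda>\<xi>. grad (\<lambda>y. ls y \<xi>) y) (grad l y)"
    and D: "D > 0" "\<And>y g \<eta>'. \<eta>' > 0 \<Longrightarrow> y \<in> K \<Longrightarrow> norm (gen_proj r \<phi> K y g \<eta>') \<le> D"
    and R: "R > 0" "\<And>y. y \<in> K \<Longrightarrow> f y \<in> {0..R}"
    and M: "prob_space M"
    and d: "\<And>t. t \<ge> 1 \<Longrightarrow> d t \<in> borel_measurable M"
    and eta: "\<eta> > 0"
    and lam: "\<And>t. t \<ge> 1 \<Longrightarrow> lam t \<in> borel_measurable M"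
      "\<And>t \<omega>. t \<ge> 1 \<Longrightarrow> \<omega> \<in> space M \<Longrightarrow> \<eta> \<le> lam t \<omega> \<and> lam t \<omega> \<le> lambar"
    and x1: "x1 \<in> K" "\<And>\<omega>. \<omega> \<in> space M \<Longrightarrow> x 1 \<omega> = x1"
    and v: "\<And>t \<omega>. t \<ge> 1 \<Longrightarrow> \<omega> \<in> space M \<Longrightarrow>
      v t \<omega> = gen_proj r \<phi> K (x t \<omega>) (d t \<omega>) (\<eta> * \<alpha> t \<omega>)"
    and x_step: "\<And>t \<omega>. t \<ge> 1 \<Longrightarrow> \<omega> \<in> space M \<Longrightarrow>
      x (t + 1) \<omega> = (1 - \<alpha> t \<omega> / \<alpha> (t + 1) \<omega>) *\<^sub>R x t \<omega> + (\<alpha> t \<omega> / \<alpha> (t + 1) \<omega>) *\<^sub>R v t \<omega>"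
    and alpha1: "\<And>\<omega>. \<omega> \<in> space M \<Longrightarrow> \<alpha> 1 \<omega> = 1"
    and alpha_step: "\<And>t \<omega>. t \<ge> 1 \<Longrightarrow> \<omega> \<in> space M \<Longrightarrow>
      \<alpha> (t + 1) \<omega> =
        max (sqrt (\<Sum>s=1..t. (lam s \<omega>)\<^sup>2 * (\<alpha> s \<omega>)\<^sup>2 * (norm (v s \<omega> - x s \<omega>))\<^sup>2)) 1"
    and expectations_defined:
      "\<And>t. t \<ge> 1 \<Longrightarrow>
        (\<lambda>\<omega>. (norm (gen_grad r \<phi> K (x t \<omega>) (grad l (x t \<omega>)) (\<eta> * \<alpha> t \<omega>)))\<^sup>2) \<in> borel_measurable M"
      "\<And>t. t \<ge> 1 \<Longrightarrow> (\<lambda>\<omega>. (norm (d t \<omega> - grad l (x t \<omega>)))\<^sup>2) \<in> borel_measurable M"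
    and T: "T \<ge> 1"
  shows "(\<integral>\<^sup>+\<omega>. ennreal (\<Sum>t=1..T.
            (norm (gen_grad r \<phi> K (x t \<omega>) (grad l (x t \<omega>)) (\<eta> * \<alpha> t \<omega>)))\<^sup>2) \<partial>M)
         \<le> ennreal (8 * R\<^sup>2 * lambar\<^sup>2 + 8 * R * \<eta> + 16 * L\<^sup>2 / \<eta>\<^sup>2)
           + 10 * (\<Sum>t=1..T. \<integral>\<^sup>+\<omega>. ennreal ((norm (d t \<omega> - grad l (x t \<omega>)))\<^sup>2) \<partial>M)"
proof -
  interpret M: prob_space M by (rule M)
  \<comment> \<open>On the trivial space \<open>L\<close> may be negative, while the energy estimate uses a nonnegative constant.
    Since only \<open>L\<^sup>2\<close> occurs in the final bound, \<open>L\<close> may be replaced by its absolute value.\<close>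
  have grad_lip: "norm (grad l y - grad l z) \<le> \<bar>L\<bar> * norm (y - z)" for y z
  proof (rule dual_expectation_diff_bound[OF N unbiased unbiased])
    fix \<xi> assume "\<xi> \<in> space N"
    then have "norm (grad (\<lambda>y. ls y \<xi>) y - grad (\<lambda>y. ls y \<xi>) z) \<le> L * norm (y - z)"
      by (rule ls_smooth)
    also have "\<dots> \<le> \<bar>L\<bar> * norm (y - z)" by (intro mult_right_mono) auto
    finally show "norm (grad (\<lambda>y. ls y \<xi>) y - grad (\<lambda>y. ls y \<xi>) z) \<le> \<bar>L\<bar> * norm (y - z)" .
  qed simp
  let ?C = "8 * R\<^sup>2 * lambar\<^sup>2 + 8 * R * \<eta> + 16 * L\<^sup>2 / \<eta>\<^sup>2"
  let ?g = "\<lambda>t \<omega>. (norm (gen_grad r \<phi> K (x t \<omega>) (grad l (x t \<omega>)) (\<eta> * \<alpha> t \<omega>)))\<^sup>2"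
  let ?s = "\<lambda>t \<omega>. (norm (d t \<omega> - grad l (x t \<omega>)))\<^sup>2"
  have pathwise: "(\<Sum>t=1..T. ?g t \<omega>) \<le> ?C + 10 * (\<Sum>t=1..T. ?s t \<omega>)"
    if \<omega>: "\<omega> \<in> space M" for \<omega>
  proof -
    define a where "a t = \<alpha> t \<omega> * norm (v t \<omega> - x t \<omega>)" for t
    have a_step: "\<alpha> (t + 1) \<omega> = max (sqrt (\<Sum>s=1..t. (lam s \<omega>)\<^sup>2 * (a s)\<^sup>2)) 1" if "t \<ge> 1" for t
      using alpha_step[OF that \<omega>] by (simp add: a_def power_mult_distrib mult.assoc)
    have mono: "\<alpha> t \<omega> \<le> \<alpha> (t + 1) \<omega>" if "t \<ge> 1" for t
    proof (cases "t = 1")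
      case True
      then show ?thesis using alpha1[OF \<omega>] a_step[of 1] by simp
    next
      case False
      with that have k: "t = (t - 1) + 1" "t - 1 \<ge> 1" by auto
      then obtain k where k: "t = k + 1" "k \<ge> 1" by blast
      have "(\<Sum>s=1..k. (lam s \<omega>)\<^sup>2 * (a s)\<^sup>2) \<le> (\<Sum>s=1..t. (lam s \<omega>)\<^sup>2 * (a s)\<^sup>2)"
        unfolding k by simp
      then show ?thesis
        unfolding a_step[OF that] a_step[OF k(2), folded k(1)]
        by (intro max.mono real_sqrt_le_mono) auto
    qed
    have ge1: "\<alpha> t \<omega> \<ge> 1" if "t \<ge> 1" for t
      using that
    proof (induction t rule: dec_induct)
      case base show ?case using alpha1[OF \<omega>] by simp
    next
      case (step t)
      then show ?case using mono[of t] by simp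
    qed
    have pos: "\<eta> * \<alpha> t \<omega> > 0" if "t \<ge> 1" for t
      using ge1[OF that] eta by simp
    have ratio: "0 \<le> \<alpha> t \<omega> / \<alpha> (t + 1) \<omega>" "\<alpha> t \<omega> / \<alpha> (t + 1) \<omega> \<le> 1" if "t \<ge> 1" for t
      using ge1[OF that] ge1[of "t + 1"] mono[OF that] by auto
    have xK: "x t \<omega> \<in> K" if "t \<ge> 1" for t
      using that
    proof (induction t rule: dec_induct)
      case base show ?case using x1 \<omega> by simp
    next
      case (step t)
      have "v t \<omega> \<in> K"
        using gen_proj_is_arg_min[OF minimisers_exist[OF step.IH pos[OF step.hyps(1)]]]
        unfolding v[OF step.hyps(1) \<omega>] is_arg_min_def by auto
      then have "x (t + 1) \<omega> \<in> K"
        unfolding x_step[OF step.hyps(1) \<omega>]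
        using K(2) step.IH ratio[OF step.hyps(1)] by (simp add: convex_alt)
      then show ?case by simp
    qed
    have descent: "\<alpha> (t + 1) \<omega> * (f (x (t + 1) \<omega>) - f (x t \<omega>))
        \<le> norm (d t \<omega> - grad l (x t \<omega>)) * a t - \<eta> * (a t)\<^sup>2 + \<bar>L\<bar> / 2 * ((a t)\<^sup>2 / \<alpha> (t + 1) \<omega>)"
      if t: "t \<ge> 1" for t
    proof -
      let ?b = "\<alpha> t \<omega> / \<alpha> (t + 1) \<omega>" and ?n = "norm (v t \<omega> - x t \<omega>)"
      let ?e = "norm (d t \<omega> - grad l (x t \<omega>))"
      have p: "\<alpha> (t + 1) \<omega> > 0" using ge1[of "t + 1"] by simp
      have "f (x (t + 1) \<omega>) \<le> f (x t \<omega>) + ?b * (?e * ?n - \<eta> * \<alpha> t \<omega> * ?n\<^sup>2)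
          + \<bar>L\<bar> / 2 * ?b\<^sup>2 * ?n\<^sup>2"
        using composite_step_decrease[OF K(2) r phi pos[OF t] xK[OF t]
            minimisers_exist[OF xK[OF t] pos[OF t]] l_differentiable grad_lip ratio[OF t] v[OF t \<omega>]]
        unfolding f x_step[OF t \<omega>] .
      then have "\<alpha> (t + 1) \<omega> * (f (x (t + 1) \<omega>) - f (x t \<omega>))
        \<le> \<alpha> (t + 1) \<omega> * (?b * (?e * ?n - \<eta> * \<alpha> t \<omega> * ?n\<^sup>2) + \<bar>L\<bar> / 2 * ?b\<^sup>2 * ?n\<^sup>2)"
        using p by (intro mult_left_mono) auto
      also have "\<dots> = ?e * a t - \<eta> * (a t)\<^sup>2 + \<bar>L\<bar> / 2 * ((a t)\<^sup>2 / \<alpha> (t + 1) \<omega>)"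
        unfolding a_def using p by (simp add: field_simps power2_eq_square)
      finally show ?thesis .
    qed
    have "\<eta>\<^sup>2 * (\<Sum>t=1..T. (a t)\<^sup>2)
        \<le> 4 * R\<^sup>2 * lambar\<^sup>2 + 4 * R * \<eta> + 8 * \<bar>L\<bar>\<^sup>2 / \<eta>\<^sup>2 + 4 * (\<Sum>t=1..T. ?s t \<omega>)"
      by (rule adaptive_energy_bound[where \<alpha> = "\<lambda>t. \<alpha> t \<omega>" and lam = "\<lambda>t. lam t \<omega>"
            and F = "\<lambda>t. f (x t \<omega>)", OF eta _ _ lam(2)[OF _ \<omega>] alpha1[OF \<omega>] a_step mono
              R(2)[OF xK] descent T]) (use R(1) in auto)
    moreover have "(\<Sum>t=1..T. ?g t \<omega>) \<le> (\<Sum>t=1..T. 2 * (\<eta>\<^sup>2 * (a t)\<^sup>2) + 2 * ?s t \<omega>)"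
    proof (rule sum_mono)
      fix t assume "t \<in> {1..T}"
      then have t: "t \<ge> 1" by simp
      show "?g t \<omega> \<le> 2 * (\<eta>\<^sup>2 * (a t)\<^sup>2) + 2 * ?s t \<omega>"
        using gen_grad_estimate[OF K(2) r phi pos[OF t] minimisers_exist[OF xK[OF t] pos[OF t]],
            of "grad l (x t \<omega>)" "d t \<omega>"]
        unfolding v[OF t \<omega>, symmetric] a_def by (simp add: power_mult_distrib mult.assoc)
    qed
    ultimately show ?thesis
      by (simp add: sum.distrib sum_distrib_left[symmetric])
  qed
  have "(\<integral>\<^sup>+\<omega>. ennreal (\<Sum>t=1..T. ?g t \<omega>) \<partial>M)
      \<le> (\<integral>\<^sup>+\<omega>. ennreal ?C + 10 * (\<Sum>t=1..T. ennreal (?s t \<omega>)) \<partial>M)"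
  proof (rule nn_integral_mono)
    fix \<omega> assume "\<omega> \<in> space M"
    from pathwise[OF this] have "ennreal (\<Sum>t=1..T. ?g t \<omega>) \<le> ennreal (?C + 10 * (\<Sum>t=1..T. ?s t \<omega>))"
      by (rule ennreal_leI)
    also have "\<dots> = ennreal ?C + 10 * (\<Sum>t=1..T. ennreal (?s t \<omega>))"
      using R(1) eta by (simp add: ennreal_plus ennreal_mult sum_nonneg)
    finally show "ennreal (\<Sum>t=1..T. ?g t \<omega>) \<le> ennreal ?C + 10 * (\<Sum>t=1..T. ennreal (?s t \<omega>))" .
  qed
  also have "\<dots> = ennreal ?C + 10 * (\<Sum>t=1..T. \<integral>\<^sup>+\<omega>. ennreal (?s t \<omega>) \<partial>M)"
  proof -
    have m: "(\<lambda>\<omega>. ennreal (?s t \<omega>)) \<in> borel_measurable M" if "t \<in> {1..T}" for t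
      using expectations_defined(2)[of t] that by simp
    have "(\<lambda>\<omega>. \<Sum>t=1..T. ennreal (?s t \<omega>)) \<in> borel_measurable M"
      using m by (rule borel_measurable_sum)
    moreover have "(\<integral>\<^sup>+\<omega>. (\<Sum>t=1..T. ennreal (?s t \<omega>)) \<partial>M) = (\<Sum>t=1..T. \<integral>\<^sup>+\<omega>. ennreal (?s t \<omega>) \<partial>M)"
      using m by (rule nn_integral_sum)
    ultimately show ?thesis
      by (simp add: nn_integral_add nn_integral_cmult M.emeasure_space_1 del: sum_ennreal)
  qed
  finally show ?thesis .
qed

end
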